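(* Let $n>5$, let $G$ be a finite group, and let $\phi\colon B_n\to G$ be a non-cyclic group homomorphism. Then \[ |\phi(B_n)|\ \geq\ \left(\left\lfloor\tfrac n2\right\rfloor+1\right)\,3^{\lfloor n/2\rfloor-1}\,\left\lceil\tfrac n2\right\rceil!\,. \] Moreover, if $p$ is the smallest positive integer such that $\phi(\sigma_i)^p=\phi(\sigma_j)^p$ for all $i,j\in\{1,\dots,n-1\}$, then \[ |\phi(B_n)|\ \geq\ \left((\mathrm{lpf}(p)-1)\left\lfloor\tfrac n2\right\rfloor+1\right)\,3^{\lfloor n/2\rfloor-1}\,\left\lceil\tfrac n2\right\rceil!\,, \] where $\mathrm{lpf}(p)$ is the least integer greater than $1$ that divides $p$.
   Context: $B_n$ is the braid group on $n$ strands: generators $\sigma_1,\dots,\sigma_{n-1}$, relations $\sigma_i\sigma_j=\sigma_j\sigma_i$ for $|i-j|\ge 2$ and $\sigma_i\sigma_{i+1}\sigma_i=\sigma_{i+1}\sigma_i\sigma_{i+1}$ for $1\le i\le n-2$. A homomorphism is called cyclic if its image is a cyclic group, and non-cyclic otherwise. *)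

theory Defs
  imports "HOL-Algebra.Elementary_Groups"
begin

section \<open>Groups given by generators and relations\<close>

text \<open>
  Group words over \<open>S\<close> are lists of signed letters: \<open>(s, True)\<close> is the generator
  \<open>s\<close> and \<open>(s, False)\<close> is its formal inverse. A pair \<open>(l, r) \<in> R\<close> is the
  relation \<open>l = r\<close>; relations are meant to be between words over \<open>S\<close>.
\<close>

type_synonym 'a gword = "('a \<times> bool) list"

definition gwords :: "'a set \<Rightarrow> 'a gword set"
  where "gwords S = lists (S \<times> UNIV)"

definition gword_inv :: "'a gword \<Rightarrow> 'a gword"
  where "gword_inv w = rev (map (\<lambda>(s, b). (s, \<not> b)) w)"

inductive pres_eq :: "'a set \<Rightarrow> ('a gword \<times> 'a gword) set \<Rightarrow> 'a gword \<Rightarrow> 'a gword \<Rightarrow> bool"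
  for S R where
  refl: "w \<in> gwords S \<Longrightarrow> pres_eq S R w w"
| sym: "pres_eq S R v w \<Longrightarrow> pres_eq S R w v"
| trans: "pres_eq S R u v \<Longrightarrow> pres_eq S R v w \<Longrightarrow> pres_eq S R u w"
| cancel: "u \<in> gwords S \<Longrightarrow> v \<in> gwords S \<Longrightarrow> s \<in> S \<Longrightarrow>
    pres_eq S R (u @ [(s, b), (s, \<not> b)] @ v) (u @ v)"
| relation: "u \<in> gwords S \<Longrightarrow> v \<in> gwords S \<Longrightarrow> (l, r) \<in> R \<Longrightarrow>
    pres_eq S R (u @ l @ v) (u @ r @ v)"

definition pres_rel :: "'a set \<Rightarrow> ('a gword \<times> 'a gword) set \<Rightarrow> 'a gword rel"
  where "pres_rel S R = {(v, w). pres_eq S R v w}"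

definition presented_group :: "'a set \<Rightarrow> ('a gword \<times> 'a gword) set \<Rightarrow> 'a gword set monoid"
  where "presented_group S R =
    \<lparr>carrier = gwords S // pres_rel S R,
     mult = (\<lambda>X Y. \<Union>x\<in>X. \<Union>y\<in>Y. pres_rel S R `` {x @ y}),
     one = pres_rel S R `` {[]}\<rparr>"

definition pres_gen :: "'a set \<Rightarrow> ('a gword \<times> 'a gword) set \<Rightarrow> 'a \<Rightarrow> 'a gword set"
  where "pres_gen S R s = pres_rel S R `` {[(s, True)]}"

lemma gwords_simps [simp]:
  "[] \<in> gwords S"
  "(s, b) # w \<in> gwords S \<longleftrightarrow> s \<in> S \<and> w \<in> gwords S"
  "v @ w \<in> gwords S \<longleftrightarrow> v \<in> gwords S \<and> w \<in> gwords S"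
  by (auto simp: gwords_def)

lemma gword_inv_simps [simp]:
  "gword_inv [] = []"
  "gword_inv ((s, b) # w) = gword_inv w @ [(s, \<not> b)]"
  by (simp_all add: gword_inv_def)

lemma gword_inv_in_gwords: "w \<in> gwords S \<Longrightarrow> gword_inv w \<in> gwords S"
  by (induction w) auto

locale group_presentation =
  fixes S :: "'a set" and R :: "('a gword \<times> 'a gword) set"
  assumes relations_wf: "R \<subseteq> gwords S \<times> gwords S"
begin

abbreviation cls :: "'a gword \<Rightarrow> 'a gword set"
  where "cls w \<equiv> pres_rel S R `` {w}"

lemma pres_eq_gwords:
  assumes "pres_eq S R v w"
  shows "v \<in> gwords S \<and> w \<in> gwords S"
  using assms by induction (use relations_wf in auto)

lemma equiv_pres_rel: "equiv (gwords S) (pres_rel S R)"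
  unfolding pres_rel_def
proof (rule equivI)
  show "{(v, w). pres_eq S R v w} \<subseteq> gwords S \<times> gwords S"
    using pres_eq_gwords by auto
  show "refl_on (gwords S) {(v, w). pres_eq S R v w}"
    using pres_eq_gwords by (auto simp: refl_on_def intro: pres_eq.refl)
  show "sym_on UNIV {(v, w). pres_eq S R v w}"
    by (auto intro: symI pres_eq.sym)
  show "trans_on UNIV {(v, w). pres_eq S R v w}"
    by (auto intro: transI pres_eq.trans)
qed

lemma pres_eq_context:
  assumes "pres_eq S R v w" "x \<in> gwords S" "y \<in> gwords S"
  shows "pres_eq S R (x @ v @ y) (x @ w @ y)"
  using assms
proof (induction)
  case (cancel u v s b)
  then show ?case using pres_eq.cancel[of "x @ u" S "v @ y" s R b] by simp
next
  case (relation u v l r)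
  then show ?case using pres_eq.relation[of "x @ u" S "v @ y" l r R] by simp
qed (auto intro: pres_eq.intros)

lemma pres_eq_append:
  assumes "pres_eq S R v v'" "pres_eq S R w w'"
  shows "pres_eq S R (v @ w) (v' @ w')"
  using pres_eq_context[OF assms(1), of "[]" w] pres_eq_context[OF assms(2), of v' "[]"]
    pres_eq_gwords[OF assms(1)] pres_eq_gwords[OF assms(2)]
  by (auto intro: pres_eq.trans)

lemma cls_eq_iff:
  "v \<in> gwords S \<Longrightarrow> w \<in> gwords S \<Longrightarrow> cls v = cls w \<longleftrightarrow> pres_eq S R v w"
  using eq_equiv_class_iff[OF equiv_pres_rel] by (simp add: pres_rel_def)

lemma carrier_eq: "carrier (presented_group S R) = cls ` gwords S"
  by (auto simp: presented_group_def quotient_def)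

lemma one_eq: "\<one>\<^bsub>presented_group S R\<^esub> = cls []"
  by (simp add: presented_group_def)

lemma mult_cls:
  assumes "v \<in> gwords S" "w \<in> gwords S"
  shows "cls v \<otimes>\<^bsub>presented_group S R\<^esub> cls w = cls (v @ w)"
proof -
  have "(\<lambda>x. \<lambda>y. cls (x @ y)) respects2 pres_rel S R"
  proof (rule congruent2I')
    fix v v' w w'
    assume "(v, v') \<in> pres_rel S R" "(w, w') \<in> pres_rel S R"
    then have "pres_eq S R (v @ w) (v' @ w')"
      by (simp add: pres_rel_def pres_eq_append)
    then show "cls (v @ w) = cls (v' @ w')"
      using cls_eq_iff pres_eq_gwords by blast
  qed
  then show ?thesis
    using UN_equiv_class2[OF equiv_pres_rel equiv_pres_rel _ assms]
    by (simp add: presented_group_def)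
qed

lemma gword_inv_left: "w \<in> gwords S \<Longrightarrow> pres_eq S R (gword_inv w @ w) []"
proof (induction w)
  case Nil
  then show ?case by (simp add: pres_eq.refl)
next
  case (Cons a w)
  obtain s b where a: "a = (s, b)" by force
  have "pres_eq S R (gword_inv w @ [(s, \<not> b), (s, \<not> \<not> b)] @ w) (gword_inv w @ w)"
    using Cons.prems a gword_inv_in_gwords by (intro pres_eq.cancel) auto
  then show ?case
    using Cons a by (auto intro: pres_eq.trans)
qed

theorem group_presented_group: "group (presented_group S R)"
proof (rule groupI)
  fix x assume "x \<in> carrier (presented_group S R)"
  then obtain w where w: "w \<in> gwords S" "x = cls w" by (auto simp: carrier_eq)
  then show "\<one>\<^bsub>presented_group S R\<^esub> \<otimes>\<^bsub>presented_group S R\<^esub> x = x"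
    by (simp add: one_eq mult_cls)
  have "cls (gword_inv w) \<otimes>\<^bsub>presented_group S R\<^esub> x = \<one>\<^bsub>presented_group S R\<^esub>"
    using w gword_inv_left by (simp add: one_eq mult_cls gword_inv_in_gwords cls_eq_iff)
  then show "\<exists>y\<in>carrier (presented_group S R).
      y \<otimes>\<^bsub>presented_group S R\<^esub> x = \<one>\<^bsub>presented_group S R\<^esub>"
    using w by (auto simp: carrier_eq gword_inv_in_gwords)
qed (auto simp: carrier_eq one_eq mult_cls)

lemma pres_gen_closed: "s \<in> S \<Longrightarrow> pres_gen S R s \<in> carrier (presented_group S R)"
  by (auto simp: pres_gen_def carrier_eq)

lemma pres_gen_inv:
  assumes "s \<in> S"
  shows "inv\<^bsub>presented_group S R\<^esub> pres_gen S R s = cls [(s, False)]"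
proof -
  interpret group "presented_group S R" by (rule group_presented_group)
  have "cls [(s, False)] \<otimes>\<^bsub>presented_group S R\<^esub> pres_gen S R s = \<one>\<^bsub>presented_group S R\<^esub>"
    using assms gword_inv_left[of "[(s, True)]"]
    by (simp add: pres_gen_def one_eq mult_cls cls_eq_iff)
  then show ?thesis
    using assms pres_gen_closed by (intro inv_equality) (auto simp: carrier_eq)
qed

end

definition gword_eval :: "('b, 'c) monoid_scheme \<Rightarrow> ('a \<Rightarrow> 'b) \<Rightarrow> 'a gword \<Rightarrow> 'b"
  where "gword_eval G f w =
    foldr (\<lambda>(s, b) y. (if b then f s else inv\<^bsub>G\<^esub> (f s)) \<otimes>\<^bsub>G\<^esub> y) w \<one>\<^bsub>G\<^esub>"

lemma gword_eval_simps [simp]: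
  "gword_eval G f [] = \<one>\<^bsub>G\<^esub>"
  "gword_eval G f ((s, b) # w) =
     (if b then f s else inv\<^bsub>G\<^esub> (f s)) \<otimes>\<^bsub>G\<^esub> gword_eval G f w"
  by (simp_all add: gword_eval_def)

lemma (in group) gword_eval_closed:
  assumes "f ` S \<subseteq> carrier G" "w \<in> gwords S"
  shows "gword_eval G f w \<in> carrier G"
  using assms by (induction w) (auto simp: image_subset_iff)

lemma (in group) gword_eval_append:
  assumes "f ` S \<subseteq> carrier G" "v \<in> gwords S" "w \<in> gwords S"
  shows "gword_eval G f (v @ w) = gword_eval G f v \<otimes> gword_eval G f w"
  using assms
proof (induction v)
  case (Cons a v)
  obtain s b where "a = (s, b)" by force
  with Cons have "s \<in> S" "v \<in> gwords S" by auto
  with Cons \<open>a = (s, b)\<close> show ?case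
    by (auto simp: m_assoc gword_eval_closed image_subset_iff)
qed (simp add: gword_eval_closed)

text \<open>The universal property of a presentation.\<close>

theorem (in group_presentation) presented_group_universal:
  fixes G (structure)
  assumes "group G" and f: "f ` S \<subseteq> carrier G"
    and R: "\<And>l r. (l, r) \<in> R \<Longrightarrow> gword_eval G f l = gword_eval G f r"
  shows "\<exists>h \<in> hom (presented_group S R) G. \<forall>s\<in>S. h (pres_gen S R s) = f s"
proof -
  interpret G: group G by fact
  have *: "gword_eval G f v = gword_eval G f w" if "pres_eq S R v w" for v w
    using that
  proof induction
    case (cancel u v s b)
    then have "f s \<in> carrier G" using f by auto
    moreover have "gword_eval G f u \<in> carrier G" "gword_eval G f v \<in> carrier G"
      using cancel f by (auto intro: G.gword_eval_closed)
    ultimately show ?case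
      using cancel f G.gword_eval_append[OF f, of u "[(s, b), (s, \<not> b)] @ v"]
        G.gword_eval_append[OF f, of u v]
      by (cases b) (auto simp flip: G.m_assoc)
  next
    case (relation u v l r)
    then show ?case
      using relations_wf R[of l r] by (auto simp: G.gword_eval_append[OF f])
  qed auto
  define h where "h X = gword_eval G f (SOME w. w \<in> X)" for X
  have h: "h (cls w) = gword_eval G f w" if "w \<in> gwords S" for w
  proof -
    have "w \<in> cls w" using that by (simp add: pres_rel_def pres_eq.refl)
    then have "(SOME v. v \<in> cls w) \<in> cls w" by (rule someI)
    then show ?thesis by (auto simp: h_def pres_rel_def dest!: *)
  qed
  have "h \<in> hom (presented_group S R) G"
    by (auto simp: hom_def carrier_eq h mult_cls G.gword_eval_append[OF f]
        G.gword_eval_closed[OF f])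
  moreover have "h (pres_gen S R s) = f s" if "s \<in> S" for s
    using that f by (auto simp: pres_gen_def h)
  ultimately show ?thesis by blast
qed


section \<open>Braid groups\<close>

definition braid_relations :: "nat \<Rightarrow> (nat gword \<times> nat gword) set"
  where "braid_relations n =
    {([(i, True), (j, True)], [(j, True), (i, True)]) | i j.
       i \<in> {1..n - 1} \<and> j \<in> {1..n - 1} \<and> \<bar>int i - int j\<bar> \<ge> 2} \<union>
    {([(i, True), (i + 1, True), (i, True)], [(i + 1, True), (i, True), (i + 1, True)]) | i.
       i \<in> {1..n - 2}}"

definition braid_group :: "nat \<Rightarrow> nat gword set monoid"
  where "braid_group n = presented_group {1..n - 1} (braid_relations n)"

definition braid_gen :: "nat \<Rightarrow> nat \<Rightarrow> nat gword set"
  where "braid_gen n i = pres_gen {1..n - 1} (braid_relations n) i"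

lemma group_presentation_braid: "group_presentation {1..n - 1} (braid_relations n)"
  by unfold_locales (auto simp: braid_relations_def)

lemma group_braid_group: "group (braid_group n)"
  unfolding braid_group_def
  by (rule group_presentation.group_presented_group[OF group_presentation_braid])

lemma braid_gen_closed: "i \<in> {1..n - 1} \<Longrightarrow> braid_gen n i \<in> carrier (braid_group n)"
  unfolding braid_group_def braid_gen_def
  by (rule group_presentation.pres_gen_closed[OF group_presentation_braid])


definition cyclic_hom :: "('a, 'c) monoid_scheme \<Rightarrow> ('b, 'd) monoid_scheme \<Rightarrow> ('a \<Rightarrow> 'b) \<Rightarrow> bool"
  where "cyclic_hom G H h \<longleftrightarrow> cyclic_group (H\<lparr>carrier := h ` carrier G\<rparr>)"

text \<open>Unspecified for \<open>p = 1\<close>, which has no divisor greater than 1.\<close>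

definition lpf :: "nat \<Rightarrow> nat"
  where "lpf p = (LEAST d. d > 1 \<and> d dvd p)"

end

theory Submission
  imports Defs "HOL-Algebra.Multiplicative_Group"
begin

text \<open>
  Let \<open>s\<^sub>i\<close> be the image of the \<open>i\<close>-th generator and let \<open>a\<^sub>i\<^sub>j\<close>, for \<open>i < j\<close>, be the image of the
  band generator \<open>(\<sigma>\<^sub>j\<^sub>-\<^sub>1 \<dots> \<sigma>\<^sub>i\<^sub>+\<^sub>1) \<sigma>\<^sub>i (\<sigma>\<^sub>j\<^sub>-\<^sub>1 \<dots> \<sigma>\<^sub>i\<^sub>+\<^sub>1)\<^sup>-\<^sup>1\<close>. If the image is not cyclic, \<open>s\<^sub>t\<close> commutes with
  \<open>a\<^sub>i\<^sub>j\<close> iff \<open>{t, t + 1}\<close> meets \<open>{i, j}\<close> in an even number of points. These sets of \<open>t\<close> determine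
  \<open>{i, j}\<close> up to complement in \<open>{1..n}\<close>, hence for \<open>n \<ge> 5\<close> the \<open>a\<^sub>i\<^sub>j\<close> are distinct. So inside
  \<open>Q\<^sub>m = \<langle>s\<^sub>1, \<dots>, s\<^sub>m\<^sub>-\<^sub>1\<rangle>\<close> the element \<open>s\<^sub>m\<^sub>-\<^sub>1\<close> has at least \<open>m (m - 1) / 2\<close> conjugates, and it is
  centralized by \<open>Q\<^sub>m\<^sub>-\<^sub>2\<close>; thus \<open>|Q\<^sub>m| \<ge> m (m - 1) / 2 * |Q\<^sub>m\<^sub>-\<^sub>2|\<close>. The recursion starts at \<open>m = 4\<close>,
  where the centralizer contains the \<open>2 p - 1\<close> distinct elements \<open>s\<^sub>1\<^sup>x\<close>, \<open>s\<^sub>3\<^sup>x\<close>, \<open>0 \<le> x < p\<close>, and at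
  \<open>m = 5\<close>, where it contains \<open>\<langle>s\<^sub>1, s\<^sub>2, s\<^sub>4\<rangle>\<close>, in which \<open>s\<^sub>1\<close> has at least three conjugates and commutes
  with the \<open>2 p - 1\<close> elements \<open>s\<^sub>1\<^sup>x\<close>, \<open>s\<^sub>4\<^sup>x\<close>. The resulting bound even holds with \<open>p\<close> in place of its
  least prime factor.
\<close>

subsection \<open>Conjugacy classes and centralizers\<close>

definition conjugate :: "('a, 'b) monoid_scheme \<Rightarrow> 'a \<Rightarrow> 'a \<Rightarrow> 'a"
  where "conjugate G g x = g \<otimes>\<^bsub>G\<^esub> x \<otimes>\<^bsub>G\<^esub> inv\<^bsub>G\<^esub> g"

context group
begin

lemma conjugate_closed [simp]:
  "g \<in> carrier G \<Longrightarrow> x \<in> carrier G \<Longrightarrow> conjugate G g x \<in> carrier G"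
  by (simp add: conjugate_def)

lemma conjugate_mult_left:
  assumes "g \<in> carrier G" "h \<in> carrier G" "x \<in> carrier G"
  shows "conjugate G (g \<otimes> h) x = conjugate G g (conjugate G h x)"
  using assms by (simp add: conjugate_def inv_mult_group m_assoc)

lemma conjugate_eq_iff:
  assumes "g \<in> carrier G" "x \<in> carrier G" "y \<in> carrier G"
  shows "conjugate G g x = y \<longleftrightarrow> g \<otimes> x = y \<otimes> g"
proof
  assume "conjugate G g x = y"
  then have "y \<otimes> g = g \<otimes> x \<otimes> (inv g \<otimes> g)"
    using assms by (auto simp: conjugate_def m_assoc)
  then show "g \<otimes> x = y \<otimes> g"
    using assms by simp
next
  assume "g \<otimes> x = y \<otimes> g"
  then show "conjugate G g x = y"
    using assms by (simp add: conjugate_def m_assoc)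
qed

lemma conjugate_mult_right:
  assumes "g \<in> carrier G" "x \<in> carrier G" "y \<in> carrier G"
  shows "conjugate G g (x \<otimes> y) = conjugate G g x \<otimes> conjugate G g y"
proof -
  have "inv g \<otimes> (g \<otimes> z) = z" if "z \<in> carrier G" for z
    using that assms by (simp flip: m_assoc)
  then show ?thesis
    using assms by (simp add: conjugate_def m_assoc)
qed

lemma conjugate_one [simp]: "g \<in> carrier G \<Longrightarrow> conjugate G g \<one> = \<one>"
  by (simp add: conjugate_def)

lemma conjugate_pow:
  assumes "g \<in> carrier G" "x \<in> carrier G"
  shows "conjugate G g (x [^] (k::nat)) = conjugate G g x [^] k"
  by (induction k) (simp_all add: assms conjugate_mult_right)

lemma conjugate_cancel [simp]:
  assumes "g \<in> carrier G" "x \<in> carrier G" "y \<in> carrier G"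
  shows "conjugate G g x = conjugate G g y \<longleftrightarrow> x = y"
  using assms by (simp add: conjugate_def)

lemma conjugate_commute_iff:
  assumes "g \<in> carrier G" "x \<in> carrier G" "y \<in> carrier G"
  shows "conjugate G g x \<otimes> conjugate G g y = conjugate G g y \<otimes> conjugate G g x
    \<longleftrightarrow> x \<otimes> y = y \<otimes> x"
  using assms conjugate_cancel[of g "x \<otimes> y" "y \<otimes> x"] by (simp add: conjugate_mult_right)

lemma conjugate_commuting:
  assumes "g \<otimes> h = h \<otimes> g" "g \<in> carrier G" "h \<in> carrier G" "x \<in> carrier G"
  shows "conjugate G g (conjugate G h x) = conjugate G h (conjugate G g x)"
  using assms by (metis conjugate_mult_left)

lemma generate_commute:
  assumes "S \<subseteq> carrier G" "x \<in> carrier G" "\<And>h. h \<in> S \<Longrightarrow> h \<otimes> x = x \<otimes> h" "y \<in> generate G S"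
  shows "y \<otimes> x = x \<otimes> y"
  using assms(4)
proof (induction y rule: generate.induct)
  case one
  then show ?case using assms by simp
next
  case (incl h)
  then show ?case using assms by simp
next
  case (inv h)
  then have h: "h \<in> carrier G" "h \<otimes> x = x \<otimes> h"
    using assms by auto
  have "inv h \<otimes> x = inv h \<otimes> (x \<otimes> h) \<otimes> inv h"
    using h(1) assms(2) by (simp add: m_assoc)
  also have "\<dots> = inv h \<otimes> (h \<otimes> x) \<otimes> inv h"
    by (simp only: h(2))
  also have "\<dots> = x \<otimes> inv h"
    using h(1) assms(2) by (simp flip: m_assoc)
  finally show ?case .
next
  case (eng h k)
  then have c: "h \<in> carrier G" "k \<in> carrier G"
    using generate_in_carrier[OF assms(1)] by auto
  have "h \<otimes> k \<otimes> x = h \<otimes> x \<otimes> k"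
    using c eng.IH(2) assms(2) by (simp add: m_assoc)
  also have "\<dots> = x \<otimes> h \<otimes> k"
    by (simp only: eng.IH(1))
  also have "\<dots> = x \<otimes> (h \<otimes> k)"
    using c assms(2) by (simp add: m_assoc)
  finally show ?case .
qed

text \<open>Orbit-stabilizer counting as an inequality; \<open>K\<close> may be any set of commuting
  elements, for instance a set of powers. With \<open>r c\<close> chosen to conjugate
  \<open>x\<close> to \<open>c\<close>, the product \<open>r c \<otimes> k\<close> still does so.
  Hence it determines \<open>c\<close>, and then \<open>k\<close> by cancellation.\<close>

lemma card_class_mult_card_centralizer_le:
  assumes H: "subgroup H G" "finite H" and x: "x \<in> carrier G"
    and C: "C \<subseteq> (\<lambda>h. conjugate G h x) ` H"
    and K: "K \<subseteq> H" "\<And>k. k \<in> K \<Longrightarrow> k \<otimes> x = x \<otimes> k"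
  shows "card C * card K \<le> card H"
proof -
  have sub: "h \<in> carrier G" if "h \<in> H" for h
    using subgroup.mem_carrier[OF H(1) that] .
  from C have "\<forall>c\<in>C. \<exists>h. h \<in> H \<and> conjugate G h x = c"
    by auto
  then obtain r where r: "c \<in> C \<Longrightarrow> r c \<in> H \<and> conjugate G (r c) x = c" for c
    by (auto dest!: bchoice)
  have conj: "conjugate G (r c \<otimes> k) x = c" if "c \<in> C" "k \<in> K" for c k
  proof -
    have "conjugate G k x = x"
      using K(2)[OF that(2)] that K(1) x sub by (subst conjugate_eq_iff) auto
    moreover have "r c \<in> carrier G" "k \<in> carrier G"
      using that K(1) r sub by auto
    ultimately show ?thesis
      using r[OF that(1)] x by (simp add: conjugate_mult_left)
  qed
  have "inj_on (\<lambda>(c, k). r c \<otimes> k) (C \<times> K)"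
  proof (rule inj_onI, clarify)
    fix c k c' k'
    assume A: "c \<in> C" "k \<in> K" "c' \<in> C" "k' \<in> K" and eq: "r c \<otimes> k = r c' \<otimes> k'"
    then have "c = c'"
      using conj[of c k] conj[of c' k'] by simp
    moreover have "k = k'"
    proof -
      have "r c \<in> carrier G" "k \<in> carrier G" "k' \<in> carrier G"
        using A r sub K(1) by auto
      with eq \<open>c = c'\<close> show ?thesis
        by simp
    qed
    ultimately show "c = c' \<and> k = k'" ..
  qed
  moreover have "(\<lambda>(c, k). r c \<otimes> k) ` (C \<times> K) \<subseteq> H"
  proof clarify
    fix c k assume "c \<in> C" "k \<in> K"
    then show "r c \<otimes> k \<in> H"
      using r K(1) by (blast intro: subgroup.m_closed[OF H(1)])
  qed
  ultimately have "card (C \<times> K) \<le> card H"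
    by (rule card_inj_on_le[OF _ _ H(2)])
  then show ?thesis
    by (simp add: card_cartesian_product)
qed

end

subsection \<open>Tuples satisfying the braid relations\<close>

locale braid_tuple = group G for G (structure) +
  fixes n :: nat and s :: "nat \<Rightarrow> 'a"
  assumes s_closed [simp]: "1 \<le> i \<Longrightarrow> i < n \<Longrightarrow> s i \<in> carrier G"
    and far_commute: "1 \<le> i \<Longrightarrow> i + 2 \<le> j \<Longrightarrow> j < n \<Longrightarrow> s i \<otimes> s j = s j \<otimes> s i"
    and braid: "1 \<le> i \<Longrightarrow> i + 1 < n \<Longrightarrow>
      s i \<otimes> s (i + 1) \<otimes> s i = s (i + 1) \<otimes> s i \<otimes> s (i + 1)"
begin

lemma conjugate_far:
  assumes "1 \<le> i" "i < n" "1 \<le> j" "j < n" "i + 2 \<le> j \<or> j + 2 \<le> i"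
  shows "conjugate G (s i) (s j) = s j"
  using assms far_commute[of i j] far_commute[of j i] by (auto simp: conjugate_eq_iff)

text \<open>Moving the conjugators to the other side turns both equations into the braid relation
  itself.\<close>

lemma conjugate_braid:
  assumes "1 \<le> i" "i + 1 < n"
  shows "conjugate G (s i) (conjugate G (s (i + 1)) (s i)) = s (i + 1)"
    and "conjugate G (s (i + 1)) (conjugate G (s i) (s (i + 1))) = s i"
proof -
  have c: "s i \<in> carrier G" "s (i + 1) \<in> carrier G"
    using assms by auto
  show "conjugate G (s i) (conjugate G (s (i + 1)) (s i)) = s (i + 1)"
    using c braid[OF assms] by (simp add: conjugate_eq_iff m_assoc flip: conjugate_mult_left)
  show "conjugate G (s (i + 1)) (conjugate G (s i) (s (i + 1))) = s i"
    using c braid[OF assms] by (simp add: conjugate_eq_iff m_assoc flip: conjugate_mult_left)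
qed

lemma conjugate_self: "1 \<le> i \<Longrightarrow> i < n \<Longrightarrow> conjugate G (s i) (s i) = s i"
  by (simp add: conjugate_eq_iff)

lemma conjugate_succ:
  assumes "1 \<le> i" "i + 1 < n"
  shows "conjugate G (s i \<otimes> s (i + 1)) (s i) = s (i + 1)"
    and "conjugate G (s (i + 1) \<otimes> s i) (s (i + 1)) = s i"
  using conjugate_braid[OF assms] assms by (simp_all add: conjugate_mult_left)

text \<open>One of the outer factors of \<open>g\<close> is far from the generator being moved or
  from its image and acts trivially; the other two factors act by the braid relation.\<close>

lemma conjugate_shift:
  assumes "1 \<le> i" "i + 2 < n"
  defines "g \<equiv> s i \<otimes> s (i + 1) \<otimes> s (i + 2)"
  shows "g \<in> carrier G" "conjugate G g (s i) = s (i + 1)" "conjugate G g (s (i + 1)) = s (i + 2)"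
proof -
  have c: "s i \<in> carrier G" "s (i + 1) \<in> carrier G" "s (i + 2) \<in> carrier G"
    using assms by auto
  then show "g \<in> carrier G"
    by (simp add: g_def)
  show "conjugate G g (s i) = s (i + 1)"
    using c assms conjugate_far[of "i + 2" i] conjugate_braid(1)[of i]
    by (simp add: g_def conjugate_mult_left)
  show "conjugate G g (s (i + 1)) = s (i + 2)"
    using c assms conjugate_far[of i "i + 2"] conjugate_braid(1)[of "i + 1"]
    by (simp add: g_def conjugate_mult_left)
qed

section \<open>Transport between pairs of consecutive generators\<close>

text \<open>The element of \<open>conjugate_shift\<close> carries each consecutive pair to the next
  one, so a conjugation-invariant relation holds for all such pairs or for none.\<close>

lemma consecutive_iff:
  assumes inv: "\<And>g x y. g \<in> carrier G \<Longrightarrow> x \<in> carrier G \<Longrightarrow> y \<in> carrier G \<Longrightarrow>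
      P (conjugate G g x) (conjugate G g y) \<longleftrightarrow> P x y"
    and "1 \<le> i" "i + 1 < n"
  shows "P (s i) (s (i + 1)) \<longleftrightarrow> P (s 1) (s 2)"
  using assms(2,3)
proof (induction i rule: nat_induct_at_least)
  case (Suc i)
  then show ?case
    using inv[of "s i \<otimes> s (i + 1) \<otimes> s (i + 2)" "s i" "s (i + 1)"] conjugate_shift[of i] by simp
qed (simp add: numeral_2_eq_2)

lemma commute_consecutive_iff:
  assumes "1 \<le> i" "i + 1 < n"
  shows "s i \<otimes> s (i + 1) = s (i + 1) \<otimes> s i \<longleftrightarrow> s 1 \<otimes> s 2 = s 2 \<otimes> s 1"
  by (rule consecutive_iff[of "\<lambda>x y. x \<otimes> y = y \<otimes> x"]) (fact assms conjugate_commute_iff)+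

lemma pow_consecutive_iff:
  fixes q :: nat
  assumes "1 \<le> i" "i + 1 < n"
  shows "s i [^] q = s (i + 1) [^] q \<longleftrightarrow> s 1 [^] q = s 2 [^] q"
  using assms
  by (rule consecutive_iff[of "\<lambda>x y. x [^] q = y [^] q", rotated]) (simp flip: conjugate_pow)

lemma all_eq_if_consecutive_eq:
  assumes "\<And>i. 1 \<le> i \<Longrightarrow> i + 1 < n \<Longrightarrow> f (s i) = f (s (i + 1))"
    and "1 \<le> i" "i < n" "1 \<le> j" "j < n"
  shows "f (s i) = f (s j)"
proof -
  have "f (s i) = f (s 1)" if "1 \<le> i" "i < n" for i
    using that
  proof (induction i rule: nat_induct_at_least)
    case (Suc i)
    then show ?case using assms(1)[of i] by simp
  qed simp
  from this[of i] this[of j] show ?thesis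
    using assms by simp
qed

text \<open>For commuting neighbours the braid relation collapses to \<open>s i = s (i + 1)\<close>.
  This is how a non-cyclic image yields \<open>s 1\<close> and \<open>s 2\<close> that do not
  commute.\<close>

lemma all_eq_if_commute:
  assumes "s 1 \<otimes> s 2 = s 2 \<otimes> s 1" "1 \<le> i" "i < n" "1 \<le> j" "j < n"
  shows "s i = s j"
proof -
  have "s i = s (i + 1)" if i: "1 \<le> i" "i + 1 < n" for i
  proof -
    have c: "s i \<in> carrier G" "s (i + 1) \<in> carrier G"
      using i by auto
    have "s i \<otimes> s (i + 1) = s (i + 1) \<otimes> s i"
      using commute_consecutive_iff[OF i] assms(1) by simp
    then have "conjugate G (s (i + 1)) (s i) = s i"
      using c by (simp only: conjugate_eq_iff)
    with conjugate_braid(1)[OF i] have "conjugate G (s i) (s i) = s (i + 1)"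
      by simp
    with c show ?thesis
      by (simp add: conjugate_eq_iff)
  qed
  then show ?thesis
    using assms(2-) by (rule all_eq_if_consecutive_eq[of "\<lambda>x. x"])
qed

lemma pow_all_eq:
  assumes "s 1 [^] (q::nat) = s 2 [^] q" "1 \<le> i" "i < n" "1 \<le> j" "j < n"
  shows "s i [^] q = s j [^] q"
proof -
  have "s i [^] q = s (i + 1) [^] q" if i: "1 \<le> i" "i + 1 < n" for i
    using pow_consecutive_iff[OF i] assms(1) by simp
  then show ?thesis
    using assms(2-) by (rule all_eq_if_consecutive_eq[of "\<lambda>x. x [^] q"])
qed

text \<open>\<open>band i d\<close> is the element \<open>a\<^sub>i\<^sub>j\<close> with \<open>j = i + d + 1\<close>.\<close>

fun band :: "nat \<Rightarrow> nat \<Rightarrow> 'a" where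
  "band i 0 = s i"
| "band i (Suc d) = conjugate G (s (i + d + 1)) (band i d)"

lemma band_closed [simp]: "1 \<le> i \<Longrightarrow> i + d < n \<Longrightarrow> band i d \<in> carrier G"
  by (induction d) auto

text \<open>Bands are built at their right end; this shortens them at the left end. The base case is
  the braid relation, and in the step \<open>s i\<close> commutes with the outermost
  conjugator.\<close>

lemma conjugate_band_left:
  assumes "1 \<le> i" "i + d + 1 < n"
  shows "conjugate G (s i) (band i (Suc d)) = band (i + 1) d"
  using assms(2)
proof (induction d)
  case 0
  then show ?case using conjugate_braid(1)[of i] assms(1) by simp
next
  case (Suc d)
  then show ?case
    using conjugate_commuting[of "s i" "s (i + Suc d + 1)" "band i (Suc d)"]
      far_commute[of i "i + Suc d + 1"] assms(1) by simp
qed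

lemma commute_band_outside:
  assumes "1 \<le> i" "i + d < n" "1 \<le> t" "t < n" "t + 1 < i \<or> i + d + 2 \<le> t"
  shows "s t \<otimes> band i d = band i d \<otimes> s t"
  using assms(2,5)
proof (induction d)
  case 0
  then show ?case using far_commute[of t i] far_commute[of i t] assms by auto
next
  case (Suc d)
  have "conjugate G (s (i + d + 1)) (s t) = s t"
    using Suc.prems assms by (intro conjugate_far) auto
  then show ?case
    using conjugate_commute_iff[of "s (i + d + 1)" "s t" "band i d"] Suc assms by auto
qed

lemma commute_band_inside:
  assumes "1 \<le> i" "i + d < n" "i < t" "t < i + d"
  shows "s t \<otimes> band i d = band i d \<otimes> s t"
  using assms(2-4)
proof (induction d)
  case (Suc d)
  show ?case
  proof (cases "t < i + d")
    case True
    have "conjugate G (s (i + d + 1)) (s t) = s t"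
      using Suc.prems assms True by (intro conjugate_far) auto
    then show ?thesis
      using conjugate_commute_iff[of "s (i + d + 1)" "s t" "band i d"] Suc assms True by auto
  next
    case False
    \<comment> \<open>Here \<open>t = i + d\<close>, so the band in the goal is
      \<open>band i e\<close> conjugated by \<open>s t\<close> and then by \<open>s (t + 1)\<close>.
      The braid relation writes \<open>s t\<close> as \<open>s (t + 1)\<close> conjugated in the
      same way, which leaves \<open>s (t + 1)\<close> against the far band
      \<open>band i e\<close>.\<close>
    define e where "e = d - 1"
    with False have e: "d = Suc e" "t = i + e + 1"
      using Suc.prems assms by auto
    have "s (t + 1) \<otimes> band i e = band i e \<otimes> s (t + 1)"
      using Suc.prems assms e by (intro commute_band_outside) auto
    moreover have "conjugate G (s (t + 1)) (conjugate G (s t) (s (t + 1))) = s t"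
      using Suc.prems assms e by (intro conjugate_braid) auto
    ultimately show ?thesis
      using conjugate_commute_iff[of "s (t + 1)" "conjugate G (s t) (s (t + 1))"
          "conjugate G (s t) (band i e)"]
        conjugate_commute_iff[of "s t" "s (t + 1)" "band i e"] Suc.prems assms e by simp
  qed
qed auto

section \<open>Subgroups belonging to the first strands\<close>

text \<open>The group \<open>Q\<^sub>m\<close>: \<open>m\<close> counts strands, so there are
  \<open>m - 1\<close> generators.\<close>

definition strand_group :: "nat \<Rightarrow> 'a set"
  where "strand_group m = generate G (s ` {1..<m})"

lemma strand_group_subgroup: "m \<le> n \<Longrightarrow> subgroup (strand_group m) G"
  unfolding strand_group_def by (rule generate_is_subgroup) auto

lemma s_in_strand_group: "1 \<le> i \<Longrightarrow> i < m \<Longrightarrow> s i \<in> strand_group m"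
  unfolding strand_group_def by (intro generate.incl) auto

lemma strand_group_mono: "m \<le> m' \<Longrightarrow> strand_group m \<subseteq> strand_group m'"
  unfolding strand_group_def by (intro mono_generate image_mono) auto

lemma conjugate_class_step:
  assumes "subgroup H G" "h \<in> H" "x \<in> carrier G" "y \<in> (\<lambda>h. conjugate G h x) ` H"
  shows "conjugate G h y \<in> (\<lambda>h. conjugate G h x) ` H"
  using assms subgroup.mem_carrier[OF assms(1)] subgroup.m_closed[OF assms(1)]
  by (auto simp flip: conjugate_mult_left)

lemma band_in_class:
  assumes "1 \<le> i" "i + d < m" "m \<le> n"
  shows "band i d \<in> (\<lambda>h. conjugate G h (s (m - 1))) ` strand_group m"
  using assms(2)
proof (induction d)
  case 0
  have "i \<le> m - 1" using 0 by simp
  \<comment> \<open>Descent from \<open>s (m - 1)\<close> to \<open>s i\<close>: each generator is a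
    conjugate of its successor by the braid relation.\<close>
  then show ?case
  proof (induction i rule: inc_induct)
    case base
    have "\<one> \<in> strand_group m"
      using strand_group_subgroup assms subgroup.one_closed by blast
    then show ?case
      using assms 0 by (auto intro!: image_eqI[of _ _ \<one>] simp: conjugate_def)
  next
    case (step k)
    have "s k = conjugate G (s (k + 1)) (conjugate G (s k) (s (k + 1)))"
      using step assms by (intro conjugate_braid[symmetric]) auto
    also have "\<dots> \<in> (\<lambda>h. conjugate G h (s (m - 1))) ` strand_group m"
      using step assms
      by (intro conjugate_class_step strand_group_subgroup s_in_strand_group) auto
    finally show ?case
      by simp
  qed
next
  case (Suc d)
  then show ?case
    using assms by (auto intro!: conjugate_class_step strand_group_subgroup s_in_strand_group)
qed

end

section \<open>Arithmetic of the recursion\<close>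

text \<open>From \<open>m\<close> to \<open>m + 2\<close> the bound grows by
  \<open>3 * (c + 1)\<close> times the quotient of \<open>q * (k + 1) + 1\<close> by
  \<open>q * k + 1\<close>, which is at most 3/2 because \<open>2 \<le> k\<close>. It remains to
  compare \<open>9 * (c + 1)\<close> with \<open>(m + 2) * (m + 1)\<close>.\<close>

lemma bound_step:
  fixes m q :: nat
  assumes "4 \<le> m"
  defines "k \<equiv> m div 2" and "c \<equiv> (m + 1) div 2"
  shows "2 * ((q * (k + 1) + 1) * 3 ^ k * fact (c + 1))
    \<le> (m + 2) * (m + 1) * ((q * k + 1) * 3 ^ (k - 1) * fact c)"
proof -
  define X :: nat where "X = 3 ^ (k - 1) * fact c"
  have k: "2 \<le> k" using assms by (simp add: k_def)
  then have pow: "(3::nat) ^ k = 3 * 3 ^ (k - 1)"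
    by (simp flip: power_Suc)
  have "q * 2 \<le> q * k"
    using k by (rule mult_le_mono2)
  then have 1: "2 * (q * (k + 1) + 1) \<le> 3 * (q * k + 1)"
    unfolding distrib_left by linarith
  have 2: "9 * (c + 1) \<le> (m + 2) * (m + 1)"
  \<comment> \<open>The estimate \<open>7 \<le> m + 2\<close> used below needs
    \<open>5 \<le> m\<close>; for \<open>m = 4\<close> the claim reads
    \<open>27 \<le> 30\<close>.\<close>
  proof (cases "m = 4")
    case False
    have "7 * (m + 1) \<le> (m + 2) * (m + 1)"
      using False assms by (intro mult_right_mono) auto
    moreover have "9 * (c + 1) \<le> 7 * (m + 1)"
      using False assms(1) by (simp add: c_def)
    ultimately show ?thesis
      by (rule order_trans[rotated])
  qed (simp add: c_def)
  have "2 * ((q * (k + 1) + 1) * 3 ^ k * fact (c + 1)) = 2 * (q * (k + 1) + 1) * (3 * (c + 1)) * X"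
    by (simp add: pow X_def algebra_simps)
  also have "\<dots> \<le> 3 * (q * k + 1) * (3 * (c + 1)) * X"
    using 1 by (intro mult_right_mono) auto
  also have "\<dots> = 9 * (c + 1) * ((q * k + 1) * X)"
    by (simp add: algebra_simps)
  also have "\<dots> \<le> (m + 2) * (m + 1) * ((q * k + 1) * X)"
    using 2 by (intro mult_right_mono) auto
  finally show ?thesis
    by (simp only: X_def mult.assoc)
qed

section \<open>Commutation of generators with bands\<close>

locale noncommuting_braid_tuple = braid_tuple +
  assumes n_ge_5: "5 \<le> n"
    and noncommute: "s 1 \<otimes> s 2 \<noteq> s 2 \<otimes> s 1"
    and finite_carrier: "finite (carrier G)"
begin

lemma consecutive_noncommute:
  "1 \<le> i \<Longrightarrow> i + 1 < n \<Longrightarrow> s i \<otimes> s (i + 1) \<noteq> s (i + 1) \<otimes> s i"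
  using commute_consecutive_iff noncommute by simp

text \<open>The outermost conjugator is far from \<open>s t\<close>, so peeling off conjugators
  reduces the band to the neighbour \<open>s (t + 1)\<close>.\<close>

lemma noncommute_band_below:
  assumes "1 \<le> t" "t + d + 1 < n"
  shows "s t \<otimes> band (t + 1) d \<noteq> band (t + 1) d \<otimes> s t"
  using assms(2)
proof (induction d)
  case 0
  then show ?case using consecutive_noncommute assms by simp
next
  case (Suc d)
  have "conjugate G (s (t + 1 + d + 1)) (s t) = s t"
    using Suc.prems assms by (intro conjugate_far) auto
  then show ?case
    using conjugate_commute_iff[of "s (t + 1 + d + 1)" "s t" "band (t + 1) d"] Suc assms by auto
qed

text \<open>Mirror image of \<open>noncommute_band_below\<close>: the band is now shortened at its
  left end, which moves its start and makes \<open>i\<close> vary in the induction.\<close>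

lemma noncommute_band_above:
  assumes "1 \<le> i" "i + d + 1 < n"
  shows "s (i + d + 1) \<otimes> band i d \<noteq> band i d \<otimes> s (i + d + 1)"
  using assms
proof (induction d arbitrary: i)
  case 0
  then show ?case using consecutive_noncommute[of i] by simp
next
  case (Suc d)
  have "conjugate G (s i) (s (i + Suc d + 1)) = s (i + Suc d + 1)"
    using Suc.prems by (intro conjugate_far) auto
  then show ?case
    using conjugate_commute_iff[of "s i" "s (i + Suc d + 1)" "band i (Suc d)"]
      conjugate_band_left[of i d] Suc.IH[of "i + 1"] Suc.prems by auto
qed

text \<open>Conjugation by \<open>s i\<close> fixes \<open>s i\<close> and removes the left end of
  the band, so that \<open>s i\<close> lies just below what remains.\<close>

lemma noncommute_band_left:
  assumes "1 \<le> i" "i + d + 1 < n"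
  shows "s i \<otimes> band i (Suc d) \<noteq> band i (Suc d) \<otimes> s i"
  using conjugate_commute_iff[of "s i" "s i" "band i (Suc d)"] conjugate_band_left[of i d]
    noncommute_band_below[of i d] conjugate_self[of i] assms by auto

lemma noncommute_band_right:
  assumes "1 \<le> i" "i + d + 1 < n"
  shows "s (i + d + 1) \<otimes> band i (Suc d) \<noteq> band i (Suc d) \<otimes> s (i + d + 1)"
  using conjugate_commute_iff[of "s (i + d + 1)" "s (i + d + 1)" "band i d"]
    noncommute_band_above[of i d] conjugate_self[of "i + d + 1"] assms by auto

text \<open>The equivalence of memberships says that an even number of \<open>t\<close>,
  \<open>t + 1\<close> are ends of the band. In this form the end sets of two equal bands can be
  compared by propositional reasoning. If \<open>t = i\<close> and \<open>d = 0\<close>, the band is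
  \<open>s t\<close> itself and both points are ends.\<close>

lemma commute_band_iff:
  assumes "1 \<le> i" "i + d < n" "1 \<le> t" "t < n"
  shows "s t \<otimes> band i d = band i d \<otimes> s t \<longleftrightarrow>
    (t \<in> {i, i + d + 1} \<longleftrightarrow> t + 1 \<in> {i, i + d + 1})"
proof -
  consider "t + 1 < i \<or> i + d + 2 \<le> t" | "t + 1 = i" | "t = i + d + 1" | "t = i" "d = 0"
    | "t = i" "d \<noteq> 0" | "t = i + d" "d \<noteq> 0" | "i < t" "t < i + d"
    by linarith
  then show ?thesis
  proof cases
    case 1
    then show ?thesis using commute_band_outside[of i d t] assms by auto
  next
    case 2
    then show ?thesis using noncommute_band_below[of t d] assms by auto
  next
    case 3
    then show ?thesis using noncommute_band_above[of i d] assms by auto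
  next
    case 4
    then show ?thesis by simp
  next
    case 5
    then obtain e where "d = Suc e"
      by (cases d) auto
    then show ?thesis using 5 noncommute_band_left[of i e] assms by auto
  next
    case 6
    then obtain e where "d = Suc e"
      by (cases d) auto
    then show ?thesis using 6 noncommute_band_right[of i e] assms by auto
  next
    case 7
    then show ?thesis using commute_band_inside[of i d t] assms by auto
  qed
qed

lemma band_eq_iff:
  assumes "1 \<le> i" "i + d < n" "1 \<le> k" "k + e < n"
  shows "band i d = band k e \<longleftrightarrow> i = k \<and> d = e"
proof
  assume eq: "band i d = band k e"
  define A B where "A = {i, i + d + 1}" and "B = {k, k + e + 1}"
  \<comment> \<open>Equal bands commute with the same generators, so whether \<open>A\<close> and
    \<open>B\<close> agree at a point does not change from \<open>t\<close> to \<open>t + 1\<close>: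
    they agree on all of \<open>{1..n}\<close> or are complementary there.\<close>
  have step: "(t \<in> A \<longleftrightarrow> t \<in> B) \<longleftrightarrow> (t + 1 \<in> A \<longleftrightarrow> t + 1 \<in> B)" if "1 \<le> t" "t < n" for t
  proof -
    have "s t \<otimes> band i d = band i d \<otimes> s t \<longleftrightarrow> (t \<in> A \<longleftrightarrow> t + 1 \<in> A)"
      unfolding A_def using assms that by (intro commute_band_iff)
    moreover have "s t \<otimes> band i d = band i d \<otimes> s t \<longleftrightarrow> (t \<in> B \<longleftrightarrow> t + 1 \<in> B)"
      unfolding B_def eq using assms that by (intro commute_band_iff)
    ultimately have "(t \<in> A \<longleftrightarrow> t + 1 \<in> A) \<longleftrightarrow> (t \<in> B \<longleftrightarrow> t + 1 \<in> B)"
      by simp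
    then show ?thesis
      by blast
  qed
  have const: "(t \<in> A \<longleftrightarrow> t \<in> B) \<longleftrightarrow> (1 \<in> A \<longleftrightarrow> 1 \<in> B)" if "1 \<le> t" "t \<le> n" for t
    using that
  proof (induction t rule: nat_induct_at_least)
    case (Suc t)
    then show ?case using step[of t] by simp
  qed simp
  have "1 \<in> A \<longleftrightarrow> 1 \<in> B"
  proof (rule ccontr)
    assume "\<not> ?thesis"
    with const have AB: "t \<in> A \<union> B" if "1 \<le> t" "t \<le> n" for t
      using that by blast
    \<comment> \<open>Complementary sets would cover five points, but there are at most four
      ends.\<close>
    have "{1..5} \<subseteq> A \<union> B"
    proof
      fix t :: nat assume "t \<in> {1..5}"
      then show "t \<in> A \<union> B"
        using n_ge_5 by (intro AB) auto
    qed
    also have "\<dots> = set [i, i + d + 1, k, k + e + 1]"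
      by (auto simp: A_def B_def)
    finally have "{1..5} \<subseteq> set [i, i + d + 1, k, k + e + 1]" .
    then have "card {1..5::nat} \<le> card (set [i, i + d + 1, k, k + e + 1])"
      by (rule card_mono[rotated]) simp
    also have "\<dots> \<le> length [i, i + d + 1, k, k + e + 1]"
      by (rule card_length)
    finally show False
      by simp
  qed
  with const have AB: "t \<in> A \<longleftrightarrow> t \<in> B" if "1 \<le> t" "t \<le> n" for t
    using that by blast
  have "A \<subseteq> {1..n}" "B \<subseteq> {1..n}"
    using assms by (auto simp: A_def B_def)
  with AB have "A = B"
    by (metis atLeastAtMost_iff subset_eq equalityI)
  then show "i = k \<and> d = e"
    by (auto simp: A_def B_def doubleton_eq_iff)
qed simp

section \<open>Counting conjugates and centralizing elements\<close>

lemma strand_group_card_ge: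
  assumes "1 \<le> m" "m \<le> n" "K \<subseteq> strand_group m"
    and "\<And>k. k \<in> K \<Longrightarrow> k \<otimes> s (m - 1) = s (m - 1) \<otimes> k"
  shows "m * (m - 1) * card K \<le> 2 * card (strand_group m)"
\<comment> \<open>For \<open>m = 1\<close> the left side vanishes; otherwise \<open>m - 1\<close> is
  the index of a generator.\<close>
proof (cases "m = 1")
  case False
  \<comment> \<open>A pair \<open>(j, i)\<close> stands for the band with ends \<open>i\<close> and
    \<open>j + 1\<close>, so \<open>P\<close> has \<open>m * (m - 1) / 2\<close> elements.\<close>
  define P where "P = (SIGMA j:{..<m}. {1..j})"
  define C where "C = (\<lambda>(j, i). band i (j - i)) ` P"
  have "inj_on (\<lambda>(j, i). band i (j - i)) P"
    using assms by (auto simp: P_def inj_on_def band_eq_iff)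
  then have "card C = card P"
    unfolding C_def by (rule card_image)
  also have "\<dots> = (\<Sum>j<m. j)"
    by (simp add: P_def)
  finally have C: "2 * card C = m * (m - 1)"
    using double_gauss_sum[of "m - 1", where ?'a = nat] assms(1)
      lessThan_Suc_atMost[of "m - 1"] by (simp add: atLeast0AtMost mult.commute)
  have "C \<subseteq> (\<lambda>h. conjugate G h (s (m - 1))) ` strand_group m"
    using assms band_in_class by (auto simp: C_def P_def)
  moreover have "finite (strand_group m)"
    using subgroup.subset[OF strand_group_subgroup[OF assms(2)]] finite_carrier
    by (rule finite_subset)
  ultimately have "card C * card K \<le> card (strand_group m)"
    using assms False strand_group_subgroup
    by (intro card_class_mult_card_centralizer_le[of _ "s (m - 1)"]) auto
  then show ?thesis
    unfolding C[symmetric] by simp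
qed simp

lemma strand_group_centralizes:
  assumes "m + 2 \<le> n" "x \<in> strand_group m"
  shows "x \<otimes> s (m + 1) = s (m + 1) \<otimes> x"
proof (rule generate_commute)
  show "x \<in> generate G (s ` {1..<m})"
    using assms(2) by (simp add: strand_group_def)
qed (use assms(1) far_commute[of _ "m + 1"] in auto)

lemma strand_group_card_step:
  assumes "m + 2 \<le> n"
  shows "(m + 2) * (m + 1) * card (strand_group m) \<le> 2 * card (strand_group (m + 2))"
  using strand_group_card_ge[of "m + 2" "strand_group m"] strand_group_centralizes[of m] assms
    strand_group_mono[of m "m + 2"] by simp

section \<open>Powers of two commuting generators\<close>

text \<open>The second range starts at 1 because the identity already occurs in the first.\<close>

definition powers :: "nat \<Rightarrow> nat \<Rightarrow> 'a set"
  where "powers p u = (\<lambda>x. s 1 [^] x) ` {..<p} \<union> (\<lambda>x. s u [^] x) ` {1..<p}"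

text \<open>Consecutive generators are conjugate, so all generators have the same order.\<close>

lemma pow_eq_one_iff:
  assumes "1 \<le> i" "i < n" "1 \<le> j" "j < n"
  shows "s i [^] (q::nat) = \<one> \<longleftrightarrow> s j [^] q = \<one>"
proof (rule all_eq_if_consecutive_eq[of "\<lambda>x. x [^] q = \<one>"])
  fix i assume i: "1 \<le> i" "i + 1 < n"
  then show "s i [^] q = \<one> \<longleftrightarrow> s (i + 1) [^] q = \<one>"
    using conjugate_cancel[of "s i \<otimes> s (i + 1)" "s i [^] q" \<one>]
      conjugate_pow[of "s i \<otimes> s (i + 1)" "s i" q] conjugate_succ(1)[OF i]
    by (simp del: conjugate_cancel)
qed (use assms in auto)

text \<open>A conjugation that exchanges \<open>s u\<close> for the other one of \<open>s 3\<close>,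
  \<open>s 4\<close> while fixing \<open>s 1\<close> shows that both have the same
  \<open>y\<close>-th power, namely \<open>s 1 [^] x\<close>. Transport to the first pair
  finishes.\<close>

lemma pow_eq_pow_imp:
  assumes "s 1 [^] (x::nat) = s u [^] (y::nat)" "u = 3 \<or> u = 4"
  shows "s 1 [^] y = s 2 [^] y"
proof -
  have c: "s 1 \<in> carrier G" "s 2 \<in> carrier G" "s 3 \<in> carrier G" "s 4 \<in> carrier G"
    using n_ge_5 by auto
  have f: "conjugate G (s 3) (s 1) = s 1" "conjugate G (s 4) (s 1) = s 1"
    using n_ge_5 by (auto intro: conjugate_far)
  have "s 3 [^] y = s 4 [^] y"
    using assms(2)
  proof
    assume "u = 3"
    with assms(1) have "conjugate G (s 3 \<otimes> s 4) (s 1 [^] x) = conjugate G (s 3 \<otimes> s 4) (s 3 [^] y)"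
      by simp
    then show ?thesis
      using c f conjugate_succ(1)[of 3] n_ge_5 assms(1) \<open>u = 3\<close>
      by (simp add: conjugate_pow conjugate_mult_left)
  next
    assume "u = 4"
    with assms(1) have "conjugate G (s 4 \<otimes> s 3) (s 1 [^] x) = conjugate G (s 4 \<otimes> s 3) (s 4 [^] y)"
      by simp
    then show ?thesis
      using c f conjugate_succ(2)[of 3] n_ge_5 assms(1) \<open>u = 4\<close>
      by (simp add: conjugate_pow conjugate_mult_left)
  qed
  then show ?thesis
    using pow_consecutive_iff[of 3 y] n_ge_5 by simp
qed

text \<open>Any coincidence among these powers gives a positive exponent below \<open>p\<close> at
  which \<open>s 1\<close> and \<open>s 2\<close> agree: \<open>y - x\<close> within one range,
  where that power is trivial, and \<open>y\<close> across the two ranges.\<close>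

lemma powers_card_ge:
  assumes p: "\<And>q. 0 < q \<Longrightarrow> s 1 [^] q = s 2 [^] q \<Longrightarrow> p \<le> q" "0 < p"
    and u: "u = 3 \<or> u = 4"
  shows "2 * (p - 1) + 1 \<le> card (powers p u)"
proof -
  have inj: "inj_on (\<lambda>x. s i [^] x) {..<p}" if i: "1 \<le> i" "i < n" for i
  proof (rule linorder_inj_onI)
    fix x y assume xy: "x < y" "x \<in> {..<p}" "y \<in> {..<p}"
    show "s i [^] x \<noteq> s i [^] y"
    proof
      assume "s i [^] x = s i [^] y"
      then have "s i [^] (y - x) = \<one>"
        using pow_eq_div2[of "s i" y x] i by simp
      then have "s 1 [^] (y - x) = s 2 [^] (y - x)"
        using pow_eq_one_iff[of i 1 "y - x"] pow_eq_one_iff[of i 2 "y - x"] i n_ge_5 by simp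
      then show False
        using p(1)[of "y - x"] xy by auto
    qed
  qed auto
  have "s 1 [^] x \<noteq> s u [^] y" if "y \<in> {1..<p}" for x y :: nat
    using pow_eq_pow_imp[of x u y] p(1)[of y] u that by auto
  then have "(\<lambda>x. s 1 [^] x) ` {..<p} \<inter> (\<lambda>x. s u [^] x) ` {1..<p} = {}"
    by auto
  moreover have "card ((\<lambda>x. s 1 [^] x) ` {..<p}) = p"
    using card_image[OF inj[of 1]] n_ge_5 by simp
  moreover have "card ((\<lambda>x. s u [^] x) ` {1..<p}) = p - 1"
    using card_image[OF inj_on_subset[OF inj[of u], of "{1..<p}"]] u n_ge_5
    by (auto simp: subset_iff)
  ultimately have "card (powers p u) = p + (p - 1)"
    unfolding powers_def by (simp add: card_Un_disjoint)
  then show ?thesis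
    using p(2) by simp
qed

lemma powers_subset:
  assumes "subgroup H G" "s 1 \<in> H" "s u \<in> H"
  shows "powers p u \<subseteq> H"
proof -
  have "x [^] (k::nat) \<in> H" if "x \<in> H" for x k
    by (induction k)
      (use that assms(1) in \<open>auto intro: subgroup.m_closed subgroup.one_closed\<close>)
  then show ?thesis
    using assms by (auto simp: powers_def)
qed

lemma powers_commute:
  assumes "z \<in> powers p u" "u = 3 \<or> u = 4" "v = 1 \<or> v = u"
  shows "z \<otimes> s v = s v \<otimes> z"
proof -
  have c: "s 1 \<in> carrier G" "s u \<in> carrier G" "s v \<in> carrier G"
    using n_ge_5 assms by auto
  have "s 1 \<otimes> s v = s v \<otimes> s 1" "s u \<otimes> s v = s v \<otimes> s u"
    using assms far_commute[of 1 u] n_ge_5 by auto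
  then have "s 1 [^] k \<otimes> s v = s v \<otimes> s 1 [^] k" "s u [^] k \<otimes> s v = s v \<otimes> s u [^] k" for k :: nat
    using group_commutes_pow c by auto
  then show ?thesis
    using assms by (auto simp: powers_def)
qed

section \<open>Starting values and recursion\<close>

lemma strand_group_4_card_ge:
  assumes p: "\<And>q. 0 < q \<Longrightarrow> s 1 [^] q = s 2 [^] q \<Longrightarrow> p \<le> q" "0 < p"
  shows "6 * (2 * (p - 1) + 1) \<le> card (strand_group 4)"
proof -
  have "4 * (4 - 1) * card (powers p 3) \<le> 2 * card (strand_group 4)"
    using n_ge_5 powers_commute[of _ p 3 3]
    by (intro strand_group_card_ge powers_subset strand_group_subgroup s_in_strand_group) auto
  then show ?thesis
    using powers_card_ge[OF p, of 3] by simp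
qed

lemma strand_group_5_card_ge:
  assumes p: "\<And>q. 0 < q \<Longrightarrow> s 1 [^] q = s 2 [^] q \<Longrightarrow> p \<le> q" "0 < p"
  shows "30 * (2 * (p - 1) + 1) \<le> card (strand_group 5)"
proof -
  define H where "H = generate G {s 1, s 2, s 4}"
  have c: "s 1 \<in> carrier G" "s 2 \<in> carrier G" "s 4 \<in> carrier G"
    using n_ge_5 by auto
  have H: "subgroup H G" "s 1 \<in> H" "s 2 \<in> H" "s 4 \<in> H"
    using c by (auto simp: H_def intro: generate_is_subgroup generate.incl)
  have fin: "finite H"
    using subgroup.subset[OF H(1)] finite_carrier by (rule finite_subset)
  have one: "conjugate G \<one> (s 1) = s 1"
    using c by (simp add: conjugate_def)
  \<comment> \<open>These are \<open>s 1\<close>, \<open>s 2\<close> and \<open>s 2\<close>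
    conjugating \<open>s 1\<close>, all reached with conjugators from \<open>H\<close>; writing them
    as bands lets \<open>band_eq_iff\<close> separate them.\<close>
  have "{band 1 0, band 2 0, band 1 1} \<subseteq> (\<lambda>h. conjugate G h (s 1)) ` H"
  proof -
    have "conjugate G (s 1 \<otimes> s 2) (s 1) = s 2"
      using conjugate_succ(1)[of 1] n_ge_5 by (simp add: numeral_2_eq_2)
    moreover have "band 1 1 = conjugate G (s 2) (s 1)"
      by (simp add: numeral_2_eq_2)
    ultimately have "{band 1 0, band 2 0, band 1 1} =
        {conjugate G \<one> (s 1), conjugate G (s 1 \<otimes> s 2) (s 1), conjugate G (s 2) (s 1)}"
      using one by simp
    then show ?thesis
      using H subgroup.one_closed[OF H(1)] subgroup.m_closed[OF H(1) H(2,3)]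
      by (simp only: insert_subset) blast
  qed
  then have "card {band 1 0, band 2 0, band 1 1} * card (powers p 4) \<le> card H"
    using H fin c powers_commute[of _ p 4 1]
    by (intro card_class_mult_card_centralizer_le powers_subset) auto
  moreover have "card {band 1 0, band 2 0, band 1 1} = 3"
    using n_ge_5 by (simp add: band_eq_iff del: band.simps One_nat_def)
  ultimately have "3 * (2 * (p - 1) + 1) \<le> card H"
    using powers_card_ge[OF p, of 4] by simp
  \<comment> \<open>All three generators of \<open>H\<close> commute with \<open>s 4\<close>, so
    \<open>H\<close> serves as the centralizing set.\<close>
  moreover have "5 * (5 - 1) * card H \<le> 2 * card (strand_group 5)"
  proof (rule strand_group_card_ge)
    show "H \<subseteq> strand_group 5"
      unfolding H_def strand_group_def by (intro mono_generate) auto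
    fix x assume "x \<in> H"
    then show "x \<otimes> s (5 - 1) = s (5 - 1) \<otimes> x"
      unfolding H_def
      by (rule generate_commute[rotated -1]) (use far_commute[of _ 4] n_ge_5 in auto)
  qed (use n_ge_5 in auto)
  ultimately show ?thesis
    by simp
qed

theorem strand_group_card_bound:
  assumes p: "\<And>q. 0 < q \<Longrightarrow> s 1 [^] q = s 2 [^] q \<Longrightarrow> p \<le> q" "0 < p"
    and "4 \<le> m" "m \<le> n"
  shows "((p - 1) * (m div 2) + 1) * 3 ^ (m div 2 - 1) * fact ((m + 1) div 2)
    \<le> card (strand_group m)"
  using assms(3,4)
proof (induction m rule: less_induct)
  case (less m)
  \<comment> \<open>The recursion moves by two strands and needs both starting values. The claim for
    \<open>m = 4\<close> is exactly \<open>strand_group_4_card_ge\<close>; for \<open>m = 5\<close>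
    it has the factor 18 where 30 is available.\<close>
  consider "m = 4" | "m = 5" | "6 \<le> m"
    using less.prems by linarith
  then show ?case
  proof cases
    case 1
    then show ?thesis using strand_group_4_card_ge[OF p] by (simp add: fact_numeral)
  next
    case 2
    then show ?thesis using strand_group_5_card_ge[OF p] by (simp add: fact_numeral)
  next
    case 3
    define l where "l = m - 2"
    with 3 have l: "m = l + 2" "4 \<le> l"
      by auto
    have "2 * (((p - 1) * (m div 2) + 1) * 3 ^ (m div 2 - 1) * fact ((m + 1) div 2))
      = 2 * (((p - 1) * (l div 2 + 1) + 1) * 3 ^ (l div 2) * fact ((l + 1) div 2 + 1))"
      using l by simp
    also have "\<dots> \<le> (l + 2) * (l + 1) *
        (((p - 1) * (l div 2) + 1) * 3 ^ (l div 2 - 1) * fact ((l + 1) div 2))"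
      using bound_step l by blast
    also have "\<dots> \<le> (l + 2) * (l + 1) * card (strand_group l)"
      using less l by (intro mult_left_mono) auto
    also have "\<dots> \<le> 2 * card (strand_group m)"
      using strand_group_card_step[of l] less.prems l by simp
    finally show ?thesis
      by simp
  qed
qed

end

subsection \<open>Homomorphisms from braid groups\<close>

context group_presentation
begin

lemma cls_relation: "(l, r) \<in> R \<Longrightarrow> cls l = cls r"
  using relations_wf pres_eq.relation[of "[]" S "[]" l r R]
  by (intro cls_eq_iff[THEN iffD2]) auto

lemma pres_gen_mult:
  assumes "s \<in> S" "w \<in> gwords S"
  shows "pres_gen S R s \<otimes>\<^bsub>presented_group S R\<^esub> cls w = cls ((s, True) # w)"
  using mult_cls[of "[(s, True)]" w] assms by (simp add: pres_gen_def)

text \<open>Every element of the presented group is the class of a word, and induction on the word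
  multiplies the images of its letters; a negative letter is the inverse of a generator.\<close>

lemma hom_image_subset_generate:
  assumes "group G" "\<phi> \<in> hom (presented_group S R) G"
  shows "\<phi> ` carrier (presented_group S R) \<subseteq> generate G ((\<lambda>s. \<phi> (pres_gen S R s)) ` S)"
proof -
  let ?P = "presented_group S R" and ?H = "generate G ((\<lambda>s. \<phi> (pres_gen S R s)) ` S)"
  interpret h: group_hom ?P G \<phi>
    using assms by (simp add: group_hom_def group_hom_axioms_def group_presented_group)
  have closed: "cls w \<in> carrier ?P" if "w \<in> gwords S" for w
    using that by (simp add: carrier_eq)
  have "\<phi> (cls w) \<in> ?H" if "w \<in> gwords S" for w
    using that
  proof (induction w)
    case Nil
    then show ?case
      by (simp add: generate.one flip: one_eq)
  next
    case (Cons a w)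
    obtain s b where a: "a = (s, b)" by force
    with Cons.prems have s: "s \<in> S" and w: "w \<in> gwords S"
      by auto
    have letter: "\<phi> (cls [(s, b)]) \<in> ?H"
    proof (cases b)
      case True
      then show ?thesis
        using s by (auto simp: pres_gen_def intro: generate.incl)
    next
      case False
      then have "cls [(s, b)] = inv\<^bsub>?P\<^esub> pres_gen S R s"
        using pres_gen_inv[OF s] by simp
      then show ?thesis
        using s pres_gen_closed[OF s] by (auto intro: generate.inv)
    qed
    have "cls (a # w) = cls [(s, b)] \<otimes>\<^bsub>?P\<^esub> cls w"
      using mult_cls[of "[(s, b)]" w] s w a by simp
    then have "\<phi> (cls (a # w)) = \<phi> (cls [(s, b)]) \<otimes>\<^bsub>G\<^esub> \<phi> (cls w)"
      using closed[of "[(s, b)]"] closed[OF w] s by simp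
    then show ?case
      using generate.eng[OF letter Cons.IH[OF w]] by simp
  qed
  then show ?thesis
    by (auto simp: carrier_eq)
qed

end

section \<open>Braid relations in the image\<close>

lemma braid_gen_far_commute:
  assumes "1 \<le> i" "i + 2 \<le> j" "j < n"
  shows "braid_gen n i \<otimes>\<^bsub>braid_group n\<^esub> braid_gen n j =
    braid_gen n j \<otimes>\<^bsub>braid_group n\<^esub> braid_gen n i"
proof -
  interpret P: group_presentation "{1..n - 1}" "braid_relations n"
    by (rule group_presentation_braid)
  have ij: "i \<in> {1..n - 1}" "j \<in> {1..n - 1}"
    using assms by auto
  have "([(i, True), (j, True)], [(j, True), (i, True)]) \<in> braid_relations n"
    using assms by (auto simp: braid_relations_def)
  from P.cls_relation[OF this] show ?thesis
    using P.pres_gen_mult[OF ij(1), of "[(j, True)]"] P.pres_gen_mult[OF ij(2), of "[(i, True)]"] ij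
    by (simp only: braid_gen_def braid_group_def pres_gen_def gwords_simps simp_thms)
qed

lemma braid_gen_braid:
  assumes "1 \<le> i" "i + 1 < n"
  shows "braid_gen n i \<otimes>\<^bsub>braid_group n\<^esub> braid_gen n (i + 1) \<otimes>\<^bsub>braid_group n\<^esub> braid_gen n i =
    braid_gen n (i + 1) \<otimes>\<^bsub>braid_group n\<^esub> braid_gen n i \<otimes>\<^bsub>braid_group n\<^esub> braid_gen n (i + 1)"
proof -
  interpret P: group_presentation "{1..n - 1}" "braid_relations n"
    by (rule group_presentation_braid)
  interpret group "braid_group n"
    by (rule group_braid_group)
  have ij: "i \<in> {1..n - 1}" "i + 1 \<in> {1..n - 1}"
    using assms by auto
  have mult: "braid_gen n a \<otimes>\<^bsub>braid_group n\<^esub> (braid_gen n b \<otimes>\<^bsub>braid_group n\<^esub> braid_gen n a) =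
      P.cls [(a, True), (b, True), (a, True)]" if "a \<in> {1..n - 1}" "b \<in> {1..n - 1}" for a b
    using P.pres_gen_mult[OF that(1), of "[(b, True), (a, True)]"]
      P.pres_gen_mult[OF that(2), of "[(a, True)]"] that
    by (simp only: braid_gen_def braid_group_def pres_gen_def gwords_simps simp_thms)
  have "([(i, True), (i + 1, True), (i, True)], [(i + 1, True), (i, True), (i + 1, True)])
      \<in> braid_relations n"
    using assms by (auto simp: braid_relations_def)
  from P.cls_relation[OF this] show ?thesis
    using mult[OF ij] mult[OF ij(2,1)] braid_gen_closed[OF ij(1)] braid_gen_closed[OF ij(2)]
    by (simp only: m_assoc m_closed)
qed

lemma braid_tuple_image:
  assumes "group G" "\<phi> \<in> hom (braid_group n) G"
  shows "braid_tuple G n (\<lambda>i. \<phi> (braid_gen n i))"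
proof -
  interpret group G by fact
  interpret B: group "braid_group n" by (rule group_braid_group)
  have gen: "braid_gen n i \<in> carrier (braid_group n)" if "1 \<le> i" "i < n" for i
    using that by (intro braid_gen_closed) auto
  show ?thesis
  proof unfold_locales
    fix i assume "1 \<le> i" "i < n"
    then show "\<phi> (braid_gen n i) \<in> carrier G"
      using gen assms(2) by (auto simp: hom_def)
  next
    fix i j assume i: "1 \<le> i" "i + 2 \<le> j" "j < n"
    then have "braid_gen n i \<in> carrier (braid_group n)" "braid_gen n j \<in> carrier (braid_group n)"
      using gen by auto
    then show "\<phi> (braid_gen n i) \<otimes>\<^bsub>G\<^esub> \<phi> (braid_gen n j) =
        \<phi> (braid_gen n j) \<otimes>\<^bsub>G\<^esub> \<phi> (braid_gen n i)"
      using braid_gen_far_commute[OF i] by (simp flip: hom_mult[OF assms(2)])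
  next
    fix i assume i: "1 \<le> i" "i + 1 < n"
    then have "braid_gen n i \<in> carrier (braid_group n)" "braid_gen n (i + 1) \<in> carrier (braid_group n)"
      using gen by auto
    then show "\<phi> (braid_gen n i) \<otimes>\<^bsub>G\<^esub> \<phi> (braid_gen n (i + 1)) \<otimes>\<^bsub>G\<^esub> \<phi> (braid_gen n i) =
        \<phi> (braid_gen n (i + 1)) \<otimes>\<^bsub>G\<^esub> \<phi> (braid_gen n i) \<otimes>\<^bsub>G\<^esub> \<phi> (braid_gen n (i + 1))"
      using braid_gen_braid[OF i] by (simp flip: hom_mult[OF assms(2)])
  qed
qed

text \<open>The image lies in the subgroup generated by the images of the generators, hence in
  \<open>generate G {x}\<close>; since \<open>x\<close> is in the image, the two coincide.\<close>

lemma cyclic_hom_if_generators_equal: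
  assumes "group G" "\<phi> \<in> hom (braid_group n) G" "x \<in> \<phi> ` carrier (braid_group n)"
    and gen: "\<And>i. i \<in> {1..n - 1} \<Longrightarrow> \<phi> (braid_gen n i) = x"
  shows "cyclic_hom (braid_group n) G \<phi>"
proof -
  interpret G: group G by fact
  interpret h: group_hom "braid_group n" G \<phi>
    using assms by (simp add: group_hom_def group_hom_axioms_def group_braid_group)
  define H where "H = \<phi> ` carrier (braid_group n)"
  have H: "subgroup H G"
    unfolding H_def by (rule h.img_is_subgroup)
  have x: "x \<in> carrier G"
    using subgroup.mem_carrier[OF H] assms(3) unfolding H_def .
  have "H \<subseteq> generate G ((\<lambda>i. \<phi> (braid_gen n i)) ` {1..n - 1})"
    using group_presentation.hom_image_subset_generate[OF group_presentation_braid assms(1)] assms(2)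
    unfolding H_def braid_group_def braid_gen_def by blast
  also have "\<dots> \<subseteq> generate G {x}"
    by (rule G.mono_generate) (use gen in blast)
  finally have "H \<subseteq> generate G {x}" .
  moreover have "generate G {x} \<subseteq> H"
    using assms(3) H by (intro G.generate_subgroup_incl) (auto simp: H_def)
  ultimately have eq: "H = generate G {x}"
    by simp
  interpret I: group "G\<lparr>carrier := H\<rparr>"
    using H by (rule G.subgroup_imp_group)
  have "x \<in> H"
    using assms(3) by (simp add: H_def)
  \<comment> \<open>Cyclicity refers to powers formed in the subgroup, which agree with those formed
    in \<open>G\<close>.\<close>
  have "range (\<lambda>k::int. x [^]\<^bsub>G\<lparr>carrier := H\<rparr>\<^esub> k) = range (\<lambda>k::int. x [^]\<^bsub>G\<^esub> k)"
    using G.int_pow_consistent[OF H \<open>x \<in> H\<close>] by (simp only:)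
  also have "\<dots> = H"
    unfolding eq G.generate_pow[OF x] by auto
  finally have "cyclic_group (G\<lparr>carrier := H\<rparr>)"
    using \<open>x \<in> H\<close> unfolding I.cyclic_group by (intro bexI[of _ x]) simp_all
  then show ?thesis
    by (simp add: cyclic_hom_def H_def)
qed

text \<open>The number \<open>p\<close> is itself a candidate for the minimum.\<close>

lemma lpf_le: "1 < p \<Longrightarrow> lpf p \<le> p"
  unfolding lpf_def by (rule Least_le) simp

section \<open>From the strand groups to the image of the homomorphism\<close>

theorem theorem1:
  fixes n :: nat and G :: "('g, 'r) monoid_scheme" and \<phi> :: "nat gword set \<Rightarrow> 'g"
  assumes "n > 5"
    and "group G" and "finite (carrier G)"
    and "\<phi> \<in> hom (braid_group n) G"
    and "\<not> cyclic_hom (braid_group n) G \<phi>"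
  shows "card (\<phi> ` carrier (braid_group n))
           \<ge> (n div 2 + 1) * 3 ^ (n div 2 - 1) * fact ((n + 1) div 2)
       \<and> (\<forall>p. p > 0
              \<and> (\<forall>i\<in>{1..n - 1}. \<forall>j\<in>{1..n - 1}.
                    \<phi> (braid_gen n i) [^]\<^bsub>G\<^esub> p = \<phi> (braid_gen n j) [^]\<^bsub>G\<^esub> p)
              \<and> (\<forall>q. q > 0
                    \<and> (\<forall>i\<in>{1..n - 1}. \<forall>j\<in>{1..n - 1}.
                          \<phi> (braid_gen n i) [^]\<^bsub>G\<^esub> q = \<phi> (braid_gen n j) [^]\<^bsub>G\<^esub> q)
                    \<longrightarrow> p \<le> q)
          \<longrightarrow> card (\<phi> ` carrier (braid_group n))
                \<ge> ((lpf p - 1) * (n div 2) + 1) * 3 ^ (n div 2 - 1) * fact ((n + 1) div 2))"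
proof -
  define s where "s i = \<phi> (braid_gen n i)" for i
  interpret G: group G by fact
  interpret h: group_hom "braid_group n" G \<phi>
    using assms by (simp add: group_hom_def group_hom_axioms_def group_braid_group)
  interpret braid_tuple G n s
    unfolding s_def using assms(2,4) by (rule braid_tuple_image)
  have not_all_equal: "\<not> (\<forall>i\<in>{1..n - 1}. s i = s 1)"
  proof
    assume *: "\<forall>i\<in>{1..n - 1}. s i = s 1"
    have "cyclic_hom (braid_group n) G \<phi>"
    proof (rule cyclic_hom_if_generators_equal[OF assms(2,4)])
      have "braid_gen n 1 \<in> carrier (braid_group n)"
        using assms(1) by (intro braid_gen_closed) simp
      then show "s 1 \<in> \<phi> ` carrier (braid_group n)"
        unfolding s_def by (rule imageI)
      show "\<phi> (braid_gen n i) = s 1" if "i \<in> {1..n - 1}" for i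
        using bspec[OF * that] by (simp only: s_def)
    qed
    with assms(5) show False ..
  qed
  interpret noncommuting_braid_tuple G n s
  proof (intro noncommuting_braid_tuple.intro noncommuting_braid_tuple_axioms.intro)
    show "braid_tuple G n s"
      by (rule braid_tuple_axioms)
    show "5 \<le> n"
      using assms(1) by simp
    show "s 1 \<otimes>\<^bsub>G\<^esub> s 2 \<noteq> s 2 \<otimes>\<^bsub>G\<^esub> s 1"
    proof
      assume comm: "s 1 \<otimes>\<^bsub>G\<^esub> s 2 = s 2 \<otimes>\<^bsub>G\<^esub> s 1"
      have "s i = s 1" if "i \<in> {1..n - 1}" for i
        by (rule all_eq_if_commute[OF comm]) (use that assms(1) in auto)
      with not_all_equal show False
        by blast
    qed
  qed (fact assms(3))
  define E where "E q \<longleftrightarrow> q > 0 \<and> (\<forall>i\<in>{1..n - 1}. \<forall>j\<in>{1..n - 1}. s i [^]\<^bsub>G\<^esub> q = s j [^]\<^bsub>G\<^esub> q)"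
    for q :: nat
  \<comment> \<open>Minimality is given for exponents that work for all pairs, while the counting
    tests only \<open>s 1\<close> and \<open>s 2\<close>; \<open>pow_all_eq\<close> bridges the
    two.\<close>
  have E_least: "p \<le> q" if "\<forall>q. E q \<longrightarrow> p \<le> q" "0 < q" "s 1 [^]\<^bsub>G\<^esub> q = s 2 [^]\<^bsub>G\<^esub> q" for p q :: nat
  proof -
    have "E q"
      unfolding E_def
    proof (intro conjI ballI)
      fix i j assume "i \<in> {1..n - 1}" "j \<in> {1..n - 1}"
      then show "s i [^]\<^bsub>G\<^esub> q = s j [^]\<^bsub>G\<^esub> q"
        using assms(1) by (intro pow_all_eq[OF that(3)]) auto
    qed (rule that(2))
    with that(1) show ?thesis by blast
  qed
  \<comment> \<open>Exponent 1 would make all generators equal. So \<open>lpf p\<close> is a genuine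
    least divisor, and \<open>1 \<le> p - 1\<close>.\<close>
  have E_gt_1: "1 < p" if "E p" for p
  proof -
    have "p \<noteq> 1"
    proof
      assume "p = 1"
      have E1: "\<forall>i\<in>{1..n - 1}. \<forall>j\<in>{1..n - 1}. s i [^]\<^bsub>G\<^esub> (1::nat) = s j [^]\<^bsub>G\<^esub> (1::nat)"
        using that unfolding E_def \<open>p = 1\<close> by (rule conjunct2)
      have "s i = s 1" if i: "i \<in> {1..n - 1}" for i
      proof -
        have one: "1 \<in> {1..n - 1}"
          using assms(1) by simp
        have c: "s i \<in> carrier G" "s 1 \<in> carrier G"
          using i assms(1) by auto
        show ?thesis
          using bspec[OF bspec[OF E1 i] one] unfolding G.nat_pow_eone[OF c(1)] G.nat_pow_eone[OF c(2)] .
      qed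
      with not_all_equal show False
        by blast
    qed
    moreover have "0 < p"
      using that unfolding E_def by (rule conjunct1)
    ultimately show ?thesis
      by simp
  qed
  have "strand_group n \<subseteq> \<phi> ` carrier (braid_group n)"
    unfolding strand_group_def
    by (rule G.generate_subgroup_incl[OF _ h.img_is_subgroup])
      (auto simp: s_def intro!: imageI braid_gen_closed)
  moreover have "finite (\<phi> ` carrier (braid_group n))"
    using subgroup.subset[OF h.img_is_subgroup] assms(3) by (rule finite_subset)
  ultimately have strand_le: "card (strand_group n) \<le> card (\<phi> ` carrier (braid_group n))"
    by (rule card_mono[rotated])
  \<comment> \<open>One estimate for both claims: \<open>a = 1\<close> gives the first and
    \<open>a = lpf p - 1\<close> the second.\<close>
  have bound: "(a * (n div 2) + 1) * 3 ^ (n div 2 - 1) * fact ((n + 1) div 2)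
      \<le> card (\<phi> ` carrier (braid_group n))"
    if p: "E p" "\<forall>q. E q \<longrightarrow> p \<le> q" and a: "a \<le> p - 1" for a p :: nat
  proof -
    have "(a * (n div 2) + 1) * 3 ^ (n div 2 - 1) * fact ((n + 1) div 2)
        \<le> ((p - 1) * (n div 2) + 1) * 3 ^ (n div 2 - 1) * fact ((n + 1) div 2)"
      using a by (intro mult_le_mono1 add_le_mono1)
    also have "\<dots> \<le> card (strand_group n)"
    proof (rule strand_group_card_bound)
      show "p \<le> q" if "0 < q" "s 1 [^]\<^bsub>G\<^esub> q = s 2 [^]\<^bsub>G\<^esub> q" for q :: nat
        using p(2) that by (rule E_least)
      show "0 < p"
        using E_gt_1[OF p(1)] by simp
    qed (use assms(1) in simp_all)
    also note strand_le
    finally show ?thesis .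
  qed
  \<comment> \<open>At the exponent \<open>order G\<close> all powers are trivial, so a least
    admissible exponent exists for the first claim.\<close>
  have "E (order G)"
    using assms(3) G.order_gt_0_iff_finite by (auto simp: E_def G.pow_order_eq_1)
  then have least: "E (LEAST q. E q)" "\<forall>q. E q \<longrightarrow> (LEAST q. E q) \<le> q"
    using LeastI[of E] Least_le[of E] by blast+
  show ?thesis
  proof (intro conjI allI impI)
    show "(n div 2 + 1) * 3 ^ (n div 2 - 1) * fact ((n + 1) div 2)
        \<le> card (\<phi> ` carrier (braid_group n))"
      using bound[OF least, of 1] E_gt_1[OF least(1)] by simp
  next
    fix p :: nat
    assume "p > 0
        \<and> (\<forall>i\<in>{1..n - 1}. \<forall>j\<in>{1..n - 1}.
              \<phi> (braid_gen n i) [^]\<^bsub>G\<^esub> p = \<phi> (braid_gen n j) [^]\<^bsub>G\<^esub> p)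
        \<and> (\<forall>q. q > 0
              \<and> (\<forall>i\<in>{1..n - 1}. \<forall>j\<in>{1..n - 1}.
                    \<phi> (braid_gen n i) [^]\<^bsub>G\<^esub> q = \<phi> (braid_gen n j) [^]\<^bsub>G\<^esub> q)
              \<longrightarrow> p \<le> q)"
    then have p: "E p" "\<forall>q. E q \<longrightarrow> p \<le> q"
      unfolding E_def s_def by blast+
    show "((lpf p - 1) * (n div 2) + 1) * 3 ^ (n div 2 - 1) * fact ((n + 1) div 2)
        \<le> card (\<phi> ` carrier (braid_group n))"
      using bound[OF p] lpf_le[OF E_gt_1[OF p(1)]] by simp
  qed
qed

end
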